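(* There is a universal constant $C'>0$ such that the following holds. Let $\{X_{i,j}\}_{i,j\in[N]}$ be real-valued random variables satisfying: (1) $\mathbb{E}\big[e^{|X_{i,j}-\mathbb{E}[X_{i,j}]|}\big]\le M$ for all $i,j\in[N]$, for some $M>0$; and (2) for $i_1,i_2,j_1,j_2\in[N]$, if $\{i_1\}\cup\{j_1\}$ and $\{i_2\}\cup\{j_2\}$ are disjoint, then $X_{i_1,j_1}$ and $X_{i_2,j_2}$ are independent. Then for any $0<\epsilon<1$, $$\mathbb{P}\left[\frac1{N^2}\sum_{i,j=1}^N(X_{i,j}-\mathbb{E}[X_{i,j}])>\epsilon\right]\le\exp\left(-\frac{C'\epsilon^2N}{M}\right)$$ and $$\mathbb{P}\left[\frac1{N^2}\sum_{i,j=1}^N(X_{i,j}-\mathbb{E}[X_{i,j}])<-\epsilon\right]\le\exp\left(-\frac{C'\epsilon^2N}{M}\right).$$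
   Context: $N\ge1$ is an integer and $[N]=\{1,\dots,N\}$. "Universal" means independent of all other quantities.
   Formalization: Condition (2) is strengthened from independence of two variables to mutual independence of every family X_{i,j} whose sets {i}∪{j} are pairwise disjoint, as the pairwise version is false (take X_{i,j}=Y_i, the nontrivial characters of F_2^k, N=2^k-1). *)

theory Defs
  imports "HOL-Probability.Probability"
begin

text \<open>
  ``Independent'' is read jointly, not merely pairwise: whenever the index sets
  \<open>{i} \<union> {j}\<close>, for \<open>(i, j)\<close> ranging over a set \<open>S\<close> of pairs, are pairwise disjoint, the family
  \<open>X i j\<close>, \<open>(i, j) \<in> S\<close>, is mutually independent.  The case of two-element \<open>S\<close> is the condition
  on pairs of variables (lemma \<open>disjoint_index_indep_pair\<close>).  Pairwise independence alone does
  not give exponential concentration: for \<open>N + 1\<close> a power of 2, take \<open>X i j = Y i\<close> with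
  \<open>Y 1, \<dots>, Y N\<close> the nontrivial characters of an elementary abelian 2-group of order \<open>N + 1\<close>
  under the uniform distribution; then the average of the \<open>X i j\<close> is 1 with probability
  \<open>1 / (N + 1)\<close>.
\<close>

definition disjoint_index_indep ::
    "'a measure \<Rightarrow> nat \<Rightarrow> (nat \<Rightarrow> nat \<Rightarrow> 'a \<Rightarrow> real) \<Rightarrow> bool" where
  "disjoint_index_indep P N X \<longleftrightarrow>
     (\<forall>S \<subseteq> {1..N} \<times> {1..N}.
        disjoint_family_on (\<lambda>(i, j). {i} \<union> {j}) S \<longrightarrow>
        prob_space.indep_vars P (\<lambda>_. borel) (\<lambda>(i, j). X i j) S)"

lemma disjoint_index_indep_pair:
  assumes P: "prob_space P" and X: "disjoint_index_indep P N X"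
    and ij: "i1 \<in> {1..N}" "j1 \<in> {1..N}" "i2 \<in> {1..N}" "j2 \<in> {1..N}"
    and disj: "({i1} \<union> {j1}) \<inter> ({i2} \<union> {j2}) = {}"
  shows "prob_space.indep_var P borel (X i1 j1) borel (X i2 j2)"
proof -
  interpret prob_space P by (rule P)
  let ?p = "(i1, j1)" and ?q = "(i2, j2)" and ?Z = "\<lambda>(i, j). X i j"
  have "disjoint_family_on (\<lambda>(i, j). {i} \<union> {j}) {?p, ?q}"
    using disj by (auto simp: disjoint_family_on_def)
  then have "indep_vars (\<lambda>_. borel) ?Z {?p, ?q}"
    using X ij by (simp add: disjoint_index_indep_def)
  then have "indep_var (Pi\<^sub>M {?p} (\<lambda>_. borel)) (\<lambda>\<omega>. restrict (\<lambda>i. ?Z i \<omega>) {?p})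
                       (Pi\<^sub>M {?q} (\<lambda>_. borel)) (\<lambda>\<omega>. restrict (\<lambda>i. ?Z i \<omega>) {?q})"
    using disj by (intro indep_var_restrict) auto
  then have "indep_var borel ((\<lambda>f. f ?p) \<circ> (\<lambda>\<omega>. restrict (\<lambda>i. ?Z i \<omega>) {?p}))
                       borel ((\<lambda>f. f ?q) \<circ> (\<lambda>\<omega>. restrict (\<lambda>i. ?Z i \<omega>) {?q}))"
    by (rule indep_var_compose) (rule measurable_component_singleton, simp)+
  then show ?thesis by (simp add: comp_def)
qed

end

(* Sort the pairs (i, j) into the 2N classes given by the residue (i + j) mod N and the truth value
   of i <= j. Within a class the sets {i, j} are disjoint, so the variables are independent
   and, after centring, the moment generating function of a class sum at t in [-1, 1] is at most
   exp (N * t^2 * M). Jensen's inequality over the classes carries this bound to the whole average,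
   and Markov's inequality with exponent \<epsilon> * N / (8 * M) finishes the proof; the lower tail
   is the upper tail of -X. *)
theory Submission
  imports Defs
begin

text \<open>Compare the exponential series from order two on: |t| \<le> 1 gives |t|^n \<le> t^2 for
  n \<ge> 2, and the tail of the series of exp |y| is at most exp |y|. The linear term is kept exact
  so that it vanishes in expectation for a centred variable.\<close>

lemma exp_mult_le_quadratic:
  fixes t y :: real
  assumes "\<bar>t\<bar> \<le> 1"
  shows "exp (t * y) \<le> 1 + t * y + t\<^sup>2 * exp \<bar>y\<bar>"
proof -
  let ?a = "\<lambda>x n. inverse (fact (n + 2)) * (x :: real) ^ (n + 2)"
  have sm: "summable (?a x)" for x
    using summable_exp[of x, THEN summable_ignore_initial_segment, of 2] by (simp add: field_simps)
  have "?a (t * y) n \<le> t\<^sup>2 * ?a \<bar>y\<bar> n" for n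
  proof -
    have "(t * y) ^ (n + 2) \<le> \<bar>t\<bar> ^ (n + 2) * \<bar>y\<bar> ^ (n + 2)"
      by (metis abs_ge_self abs_mult power_abs power_mult_distrib)
    also have "\<dots> \<le> \<bar>t\<bar>\<^sup>2 * \<bar>y\<bar> ^ (n + 2)"
      using assms by (intro mult_right_mono power_decreasing) auto
    finally show ?thesis
      by (subst mult.left_commute) (intro mult_left_mono, auto)
  qed
  then have "(\<Sum>n. ?a (t * y) n) \<le> (\<Sum>n. t\<^sup>2 * ?a \<bar>y\<bar> n)"
    by (intro suminf_le sm summable_mult)
  also have "\<dots> = t\<^sup>2 * (\<Sum>n. ?a \<bar>y\<bar> n)"
    by (intro suminf_mult sm)
  also have "\<dots> \<le> t\<^sup>2 * exp \<bar>y\<bar>"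
    using exp_first_two_terms[of "\<bar>y\<bar>"] by (intro mult_left_mono) auto
  finally show ?thesis
    using exp_first_two_terms[of "t * y"] by simp
qed

lemma (in prob_space) centred_mgf_bound:
  fixes Y :: "'a \<Rightarrow> real" and t K :: real
  assumes Y: "integrable M Y" "expectation Y = 0"
    and E: "integrable M (\<lambda>\<omega>. exp \<bar>Y \<omega>\<bar>)" "expectation (\<lambda>\<omega>. exp \<bar>Y \<omega>\<bar>) \<le> K"
    and t: "\<bar>t\<bar> \<le> 1"
  shows "integrable M (\<lambda>\<omega>. exp (t * Y \<omega>))"
    and "expectation (\<lambda>\<omega>. exp (t * Y \<omega>)) \<le> exp (t\<^sup>2 * K)"
proof -
  have [measurable]: "Y \<in> borel_measurable M"
    using Y by auto
  \<comment> \<open>Hence exp |Y| dominates exp (t * Y), which gives integrability.\<close>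
  have "t * y \<le> \<bar>y\<bar>" for y :: real
    using mult_right_mono[OF t, of "\<bar>y\<bar>"] by (simp add: abs_mult[symmetric])
  then show int: "integrable M (\<lambda>\<omega>. exp (t * Y \<omega>))"
    by (intro Bochner_Integration.integrable_bound[OF E(1)]) auto
  have "expectation (\<lambda>\<omega>. exp (t * Y \<omega>)) \<le> expectation (\<lambda>\<omega>. 1 + t * Y \<omega> + t\<^sup>2 * exp \<bar>Y \<omega>\<bar>)"
    using Y E t by (intro integral_mono int exp_mult_le_quadratic) auto
  also have "\<dots> = 1 + t\<^sup>2 * expectation (\<lambda>\<omega>. exp \<bar>Y \<omega>\<bar>)"
    using Y E by (simp add: prob_space)
  also have "\<dots> \<le> 1 + t\<^sup>2 * K"
    using E by (intro add_left_mono mult_left_mono) auto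
  \<comment> \<open>The exponential form makes the bounds multiply well over independent
    variables.\<close>
  also have "\<dots> \<le> exp (t\<^sup>2 * K)"
    by (rule exp_ge_add_one_self)
  finally show "expectation (\<lambda>\<omega>. exp (t * Y \<omega>)) \<le> exp (t\<^sup>2 * K)" .
qed

lemma (in prob_space) indep_sum_mgf_bound:
  fixes Y :: "'b \<Rightarrow> 'a \<Rightarrow> real" and t K :: real
  assumes S: "finite S" and indep: "indep_vars (\<lambda>_. borel) Y S"
    and Y: "\<And>p. p \<in> S \<Longrightarrow> integrable M (Y p)" "\<And>p. p \<in> S \<Longrightarrow> expectation (Y p) = 0"
    and E: "\<And>p. p \<in> S \<Longrightarrow> integrable M (\<lambda>\<omega>. exp \<bar>Y p \<omega>\<bar>)"
           "\<And>p. p \<in> S \<Longrightarrow> expectation (\<lambda>\<omega>. exp \<bar>Y p \<omega>\<bar>) \<le> K"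
    and t: "\<bar>t\<bar> \<le> 1"
  shows "integrable M (\<lambda>\<omega>. exp (t * (\<Sum>p\<in>S. Y p \<omega>)))"
    and "expectation (\<lambda>\<omega>. exp (t * (\<Sum>p\<in>S. Y p \<omega>))) \<le> exp (card S * (t\<^sup>2 * K))"
proof -
  have indep': "indep_vars (\<lambda>_. borel) (\<lambda>p \<omega>. exp (t * Y p \<omega>)) S"
    by (rule indep_vars_compose2[OF indep]) simp
  have int: "integrable M (\<lambda>\<omega>. exp (t * Y p \<omega>))" if "p \<in> S" for p
    using that by (intro centred_mgf_bound(1)[OF Y E t])
  have eq: "exp (t * (\<Sum>p\<in>S. Y p \<omega>)) = (\<Prod>p\<in>S. exp (t * Y p \<omega>))" for \<omega>
    using S by (simp add: sum_distrib_left exp_sum)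
  show "integrable M (\<lambda>\<omega>. exp (t * (\<Sum>p\<in>S. Y p \<omega>)))"
    unfolding eq by (rule indep_vars_integrable[OF S indep' int])
  have "expectation (\<lambda>\<omega>. exp (t * (\<Sum>p\<in>S. Y p \<omega>))) =
      (\<Prod>p\<in>S. expectation (\<lambda>\<omega>. exp (t * Y p \<omega>)))"
    unfolding eq by (rule indep_vars_lebesgue_integral[OF S indep' int])
  also have "\<dots> \<le> (\<Prod>p\<in>S. exp (t\<^sup>2 * K))"
    using centred_mgf_bound(2)[OF Y E t] by (intro prod_mono) (auto intro: integral_nonneg_AE)
  also have "\<dots> = exp (card S * (t\<^sup>2 * K))"
    by (simp add: exp_of_nat_mult)
  finally show "expectation (\<lambda>\<omega>. exp (t * (\<Sum>p\<in>S. Y p \<omega>))) \<le> exp (card S * (t\<^sup>2 * K))" .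
qed

text \<open>With the residue fixed, either coordinate determines the other. The truth value
  separates (i, j) from (j, i), which share both their residue and their index set.\<close>

definition index_class :: "nat \<Rightarrow> nat \<times> bool \<Rightarrow> (nat \<times> nat) set" where
  "index_class N k = {p \<in> {1..N} \<times> {1..N}. ((fst p + snd p) mod N, fst p \<le> snd p) = k}"

text \<open>N divides the difference of j and j', which is smaller than N and therefore 0.\<close>

lemma add_mod_eq_cancel:
  fixes N :: nat
  assumes "(i + j) mod N = (i + j') mod N" "j \<in> {1..N}" "j' \<in> {1..N}"
  shows "j = j'"
proof (cases "j \<le> j'")
  case True
  then have "N dvd (i + j') - (i + j)"
    using assms(1) mod_eq_dvd_iff_nat[of "i + j" "i + j'" N] by simp
  then show ?thesis
    using assms(2,3) True by (auto dest: dvd_imp_le)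
next
  case False
  then have "N dvd (i + j) - (i + j')"
    using assms(1) mod_eq_dvd_iff_nat[of "i + j'" "i + j" N] by simp
  then show ?thesis
    using assms(2,3) False by (auto dest: dvd_imp_le)
qed

lemma disjoint_family_index_class:
  "disjoint_family_on (\<lambda>(i, j). {i} \<union> {j}) (index_class N k)"
  unfolding disjoint_family_on_def
proof (intro ballI impI)
  fix p q assume pq: "p \<in> index_class N k" "q \<in> index_class N k" "p \<noteq> q"
  obtain i j i' j' where [simp]: "p = (i, j)" "q = (i', j')"
    by (cases p, cases q) auto
  have m: "(i + j) mod N = (i' + j') mod N" and o: "i \<le> j \<longleftrightarrow> i' \<le> j'"
    and r: "i \<in> {1..N}" "j \<in> {1..N}" "i' \<in> {1..N}" "j' \<in> {1..N}"
    using pq by (auto simp: index_class_def)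
  \<comment> \<open>By the common residue, one shared index forces the remaining two indices to
    agree, so q is (i, j) or (j, i).\<close>
  have "i = i' \<Longrightarrow> j = j'" "i = j' \<Longrightarrow> j = i'" "j = i' \<Longrightarrow> i = j'" "j = j' \<Longrightarrow> i = i'"
    using m r add_mod_eq_cancel[of i j N j'] add_mod_eq_cancel[of i j N i']
      add_mod_eq_cancel[of j i N j'] add_mod_eq_cancel[of j i N i']
    by (simp_all add: add.commute)
  \<comment> \<open>If q = (j, i), the common truth value forces i = j, so that p = q in this case
    too.\<close>
  moreover have "\<not> (i = i' \<and> j = j')" "\<not> (i = j' \<and> j = i')"
    using pq(3) o by auto
  ultimately have "i \<noteq> i'" "i \<noteq> j'" "j \<noteq> i'" "j \<noteq> j'"
    by blast+
  then show "(case p of (i, j) \<Rightarrow> {i} \<union> {j}) \<inter> (case q of (i, j) \<Rightarrow> {i} \<union> {j}) = {}"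
    by auto
qed

lemma card_index_class_le: "card (index_class N k) \<le> N"
proof -
  \<comment> \<open>Two distinct pairs with the same first coordinate would have intersecting index
    sets.\<close>
  have "inj_on fst (index_class N k)"
  proof (rule inj_onI, rule ccontr)
    fix p q assume "p \<in> index_class N k" "q \<in> index_class N k" "fst p = fst q" "p \<noteq> q"
    then show False
      using disjoint_family_onD[OF disjoint_family_index_class, of p N k q]
      by (simp add: case_prod_unfold)
  qed
  then have "card (index_class N k) \<le> card {1..N}"
    by (rule card_inj_on_le) (auto simp: index_class_def)
  then show ?thesis
    by simp
qed

lemma sum_index_class:
  fixes f :: "nat \<Rightarrow> nat \<Rightarrow> real"
  assumes "N \<ge> 1"
  shows "(\<Sum>i=1..N. \<Sum>j=1..N. f i j) =
    (\<Sum>k\<in>{..<N} \<times> UNIV. \<Sum>(i, j)\<in>index_class N k. f i j)"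
  unfolding index_class_def sum.cartesian_product
  \<comment> \<open>N \<ge> 1 puts every residue into \<open>{..<N}\<close>, so each pair falls into
    exactly one of the listed classes.\<close>
  by (rule sum.group[symmetric]) (use assms in auto)

text \<open>Stated for centred arrays so that it applies to X minus its mean and to the negative of
  that array, which yields both tails.\<close>

lemma (in prob_space) centred_array_upper_tail:
  fixes Y :: "nat \<Rightarrow> nat \<Rightarrow> 'a \<Rightarrow> real" and K \<epsilon> :: real
  assumes N: "N \<ge> 1" and indep: "disjoint_index_indep M N Y"
    and Y: "\<And>i j. i \<in> {1..N} \<Longrightarrow> j \<in> {1..N} \<Longrightarrow> integrable M (Y i j)"
           "\<And>i j. i \<in> {1..N} \<Longrightarrow> j \<in> {1..N} \<Longrightarrow> expectation (Y i j) = 0"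
    and E: "\<And>i j. i \<in> {1..N} \<Longrightarrow> j \<in> {1..N} \<Longrightarrow> integrable M (\<lambda>\<omega>. exp \<bar>Y i j \<omega>\<bar>)"
           "\<And>i j. i \<in> {1..N} \<Longrightarrow> j \<in> {1..N} \<Longrightarrow> expectation (\<lambda>\<omega>. exp \<bar>Y i j \<omega>\<bar>) \<le> K"
    and eps: "0 < \<epsilon>" "\<epsilon> < 1"
  shows "prob {\<omega> \<in> space M. 1 / (real N)\<^sup>2 * (\<Sum>i=1..N. \<Sum>j=1..N. Y i j \<omega>) > \<epsilon>}
    \<le> exp (- (1 / 16 * \<epsilon>\<^sup>2 * real N / K))"
proof -
  \<comment> \<open>exp |Y| is at least 1 pointwise, hence K \<ge> 1. Together with \<epsilon> < 1
    this ensures |t| \<le> 1 below.\<close>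
  have "1 \<le> expectation (\<lambda>\<omega>. exp \<bar>Y 1 1 \<omega>\<bar>)"
    using N E(1)[of 1 1] by (intro integral_ge_const) auto
  with N E(2)[of 1 1] have K: "1 \<le> K"
    by simp
  \<comment> \<open>If A is the whole average, s * A is the mean of t * Z k over the 2N classes
    exactly when t = 2 * s / N. The final exponent is then - s * \<epsilon> + 4 * s^2 * K / N, and
    this s minimises it.\<close>
  define s t where "s = \<epsilon> * N / (8 * K)" and "t = \<epsilon> / (4 * K)"
  have s: "s > 0"
    using eps K N by (simp add: s_def)
  have t: "\<bar>t\<bar> \<le> 1"
    using eps K by (simp add: t_def field_simps)
  let ?I = "{..<N} \<times> (UNIV :: bool set)"
  define Z where "Z k \<omega> = (\<Sum>(i, j)\<in>index_class N k. Y i j \<omega>)" for k \<omega>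
  define A where "A \<omega> = 1 / (real N)\<^sup>2 * (\<Sum>i=1..N. \<Sum>j=1..N. Y i j \<omega>)" for \<omega>
  have sub: "index_class N k \<subseteq> {1..N} \<times> {1..N}" for k
    by (auto simp: index_class_def)
  have fin: "finite (index_class N k)" for k
    by (rule finite_subset[OF sub]) simp
  have ind: "indep_vars (\<lambda>_. borel) (\<lambda>(i, j). Y i j) (index_class N k)" for k
    using indep sub disjoint_family_index_class unfolding disjoint_index_indep_def by blast
  have Zeq: "Z k \<omega> = (\<Sum>p\<in>index_class N k. (case p of (i, j) \<Rightarrow> Y i j) \<omega>)" for k \<omega>
    by (simp add: Z_def case_prod_unfold)
  have Zint: "integrable M (\<lambda>\<omega>. exp (t * Z k \<omega>))" for k
    unfolding Zeq using sub[of k] Y E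
    by (intro indep_sum_mgf_bound(1)[where K = K, OF fin ind _ _ _ _ t]) auto
  have Zle: "expectation (\<lambda>\<omega>. exp (t * Z k \<omega>)) \<le> exp (N * (t\<^sup>2 * K))" for k
  proof -
    have "expectation (\<lambda>\<omega>. exp (t * Z k \<omega>)) \<le> exp (card (index_class N k) * (t\<^sup>2 * K))"
      unfolding Zeq using sub[of k] Y E
      by (intro indep_sum_mgf_bound(2)[OF fin ind _ _ _ _ t]) auto
    also have "\<dots> \<le> exp (N * (t\<^sup>2 * K))"
      using card_index_class_le[of N k] K by (auto intro!: mult_right_mono)
    finally show ?thesis .
  qed
  have cI: "real (card ?I) = 2 * real N"
    by (simp add: card_cartesian_product)
  \<comment> \<open>Different classes may be dependent. Convexity of exp with equal weights 1 / (2N)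
    avoids any need for independence between them.\<close>
  have jensen: "exp (s * A \<omega>) \<le> (\<Sum>k\<in>?I. 1 / (2 * real N) * exp (t * Z k \<omega>))" for \<omega>
  proof -
    have "s * A \<omega> = s / (real N)\<^sup>2 * (\<Sum>k\<in>?I. Z k \<omega>)"
      unfolding A_def Z_def sum_index_class[OF N] by simp
    also have "s / (real N)\<^sup>2 = 1 / (2 * real N) * t"
      using N K by (simp add: s_def t_def field_simps power2_eq_square)
    also have "\<dots> * (\<Sum>k\<in>?I. Z k \<omega>) = (\<Sum>k\<in>?I. (1 / (2 * real N)) *\<^sub>R (t * Z k \<omega>))"
      by (simp add: sum_distrib_left mult.assoc)
    also have "exp \<dots> \<le> (\<Sum>k\<in>?I. 1 / (2 * real N) * exp (t * Z k \<omega>))"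
      using N cI by (intro convex_on_sum[OF _ _ exp_convex]) (auto simp: lessThan_empty_iff)
    finally show ?thesis .
  qed
  have [measurable]: "A \<in> borel_measurable M"
    unfolding A_def using Y(1) by (intro borel_measurable_times borel_measurable_sum) auto
  have rint: "integrable M (\<lambda>\<omega>. \<Sum>k\<in>?I. 1 / (2 * real N) * exp (t * Z k \<omega>))"
    using Zint by (intro Bochner_Integration.integrable_sum integrable_mult_right) auto
  have Aint: "integrable M (\<lambda>\<omega>. exp (s * A \<omega>))"
  proof (rule Bochner_Integration.integrable_bound[OF rint])
    show "AE \<omega> in M. norm (exp (s * A \<omega>)) \<le>
        norm (\<Sum>k\<in>?I. 1 / (2 * real N) * exp (t * Z k \<omega>))"
      using order_trans[OF jensen abs_ge_self] by simp
  qed simp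
  have "expectation (\<lambda>\<omega>. exp (s * A \<omega>)) \<le>
      expectation (\<lambda>\<omega>. \<Sum>k\<in>?I. 1 / (2 * real N) * exp (t * Z k \<omega>))"
    by (intro integral_mono Aint rint jensen)
  also have "\<dots> = (\<Sum>k\<in>?I. 1 / (2 * real N) * expectation (\<lambda>\<omega>. exp (t * Z k \<omega>)))"
    using Zint by (subst Bochner_Integration.integral_sum) auto
  also have "\<dots> \<le> (\<Sum>k\<in>?I. 1 / (2 * real N) * exp (N * (t\<^sup>2 * K)))"
    by (intro sum_mono mult_left_mono Zle) auto
  also have "\<dots> = exp (N * (t\<^sup>2 * K))"
    using N cI by simp
  finally have mgf: "expectation (\<lambda>\<omega>. exp (s * A \<omega>)) \<le> exp (N * (t\<^sup>2 * K))" .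
  \<comment> \<open>The event is enlarged to the non-strict one, the form that
    \<open>Chernoff_ineq_ge\<close> bounds.\<close>
  have "prob {\<omega> \<in> space M. A \<omega> > \<epsilon>} \<le> prob {\<omega> \<in> space M. A \<omega> \<ge> \<epsilon>}"
    by (intro finite_measure_mono) auto
  also have "\<dots> \<le> exp (- s * \<epsilon>) * (\<integral>\<omega>\<in>space M. exp (s * A \<omega>) \<partial>M)"
    by (intro Chernoff_ineq_ge[unfolded set_integrable_def] s integrable_mult_indicator Aint) auto
  also have "\<dots> = exp (- s * \<epsilon>) * expectation (\<lambda>\<omega>. exp (s * A \<omega>))"
    using Aint by (simp add: set_integral_space)
  also have "\<dots> \<le> exp (- s * \<epsilon>) * exp (N * (t\<^sup>2 * K))"
    by (intro mult_left_mono mgf) auto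
  \<comment> \<open>In units of \<epsilon>^2 * N / K, s * \<epsilon> is 1/8 and N * t^2 * K is 1/16,
    leaving -1/16.\<close>
  also have "\<dots> = exp (- (1 / 16 * \<epsilon>\<^sup>2 * real N / K))"
    using K by (simp add: exp_add[symmetric] s_def t_def field_simps power2_eq_square)
  finally show ?thesis
    unfolding A_def .
qed

text \<open>Used to centre the array and to change its sign. The map \<open>f i j\<close> may vary
  with the pair because the means do.\<close>

lemma (in prob_space) disjoint_index_indep_compose:
  assumes "disjoint_index_indep M N X" "\<And>i j. f i j \<in> borel_measurable borel"
  shows "disjoint_index_indep M N (\<lambda>i j \<omega>. f i j (X i j \<omega>))"
  unfolding disjoint_index_indep_def
proof (intro allI impI)
  fix S assume "S \<subseteq> {1..N} \<times> {1..N}" "disjoint_family_on (\<lambda>(i, j). {i} \<union> {j}) S"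
  then have "indep_vars (\<lambda>_. borel) (\<lambda>(i, j). X i j) S"
    using assms(1) by (simp add: disjoint_index_indep_def)
  then have "indep_vars (\<lambda>_. borel) (\<lambda>p \<omega>. (case p of (i, j) \<Rightarrow> f i j) ((case p of (i, j) \<Rightarrow> X i j) \<omega>)) S"
    by (rule indep_vars_compose2) (use assms(2) in auto)
  also have "(\<lambda>p \<omega>. (case p of (i, j) \<Rightarrow> f i j) ((case p of (i, j) \<Rightarrow> X i j) \<omega>)) =
      (\<lambda>(i, j) \<omega>. f i j (X i j \<omega>))"
    by auto
  finally show "indep_vars (\<lambda>_. borel) (\<lambda>(i, j) \<omega>. f i j (X i j \<omega>)) S" .
qed

theorem lemmaD11:
  shows "\<exists>C'::real. C' > 0 \<and>
    (\<forall>(N::nat) (P::'a measure) (X::nat \<Rightarrow> nat \<Rightarrow> 'a \<Rightarrow> real) (M::real).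
       N \<ge> 1 \<longrightarrow> prob_space P \<longrightarrow>
       (\<forall>i\<in>{1..N}. \<forall>j\<in>{1..N}. integrable P (X i j)) \<longrightarrow>
       M > 0 \<longrightarrow>
       (\<forall>i\<in>{1..N}. \<forall>j\<in>{1..N}.
          integrable P (\<lambda>\<omega>. exp \<bar>X i j \<omega> - integral\<^sup>L P (X i j)\<bar>) \<and>
          (LINT \<omega>|P. exp \<bar>X i j \<omega> - integral\<^sup>L P (X i j)\<bar>) \<le> M) \<longrightarrow>
       disjoint_index_indep P N X \<longrightarrow>
       (\<forall>\<epsilon>::real. 0 < \<epsilon> \<longrightarrow> \<epsilon> < 1 \<longrightarrow>
          measure P {\<omega> \<in> space P.
              1 / (real N)\<^sup>2 * (\<Sum>i=1..N. \<Sum>j=1..N. X i j \<omega> - integral\<^sup>L P (X i j)) > \<epsilon>}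
            \<le> exp (- (C' * \<epsilon>\<^sup>2 * real N / M)) \<and>
          measure P {\<omega> \<in> space P.
              1 / (real N)\<^sup>2 * (\<Sum>i=1..N. \<Sum>j=1..N. X i j \<omega> - integral\<^sup>L P (X i j)) < - \<epsilon>}
            \<le> exp (- (C' * \<epsilon>\<^sup>2 * real N / M))))"
proof (intro exI[of _ "1 / 16"] conjI allI impI)
  fix N :: nat and P :: "'a measure" and X :: "nat \<Rightarrow> nat \<Rightarrow> 'a \<Rightarrow> real" and M \<epsilon> :: real
  assume N: "N \<ge> 1" and P: "prob_space P"
    and X: "\<forall>i\<in>{1..N}. \<forall>j\<in>{1..N}. integrable P (X i j)"
    and E: "\<forall>i\<in>{1..N}. \<forall>j\<in>{1..N}.
          integrable P (\<lambda>\<omega>. exp \<bar>X i j \<omega> - integral\<^sup>L P (X i j)\<bar>) \<and>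
          (LINT \<omega>|P. exp \<bar>X i j \<omega> - integral\<^sup>L P (X i j)\<bar>) \<le> M"
    and indep: "disjoint_index_indep P N X" and eps: "0 < \<epsilon>" "\<epsilon> < 1"
  interpret prob_space P by (rule P)
  let ?U = "\<lambda>i j \<omega>. X i j \<omega> - expectation (X i j)"
  let ?L = "\<lambda>i j \<omega>. expectation (X i j) - X i j \<omega>"
  have U: "disjoint_index_indep P N ?U" and L: "disjoint_index_indep P N ?L"
    by (rule disjoint_index_indep_compose[OF indep], simp)+
  show "prob {\<omega> \<in> space P. 1 / (real N)\<^sup>2 * (\<Sum>i=1..N. \<Sum>j=1..N. ?U i j \<omega>) > \<epsilon>}
      \<le> exp (- (1 / 16 * \<epsilon>\<^sup>2 * real N / M))"
    using X E by (intro centred_array_upper_tail[OF N U _ _ _ _ eps]) (auto simp: prob_space)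
  have "(\<Sum>i=1..N. \<Sum>j=1..N. ?L i j \<omega>) = - (\<Sum>i=1..N. \<Sum>j=1..N. ?U i j \<omega>)" for \<omega>
    by (simp add: sum_negf[symmetric])
  then have "{\<omega> \<in> space P. 1 / (real N)\<^sup>2 * (\<Sum>i=1..N. \<Sum>j=1..N. ?U i j \<omega>) < - \<epsilon>} =
      {\<omega> \<in> space P. 1 / (real N)\<^sup>2 * (\<Sum>i=1..N. \<Sum>j=1..N. ?L i j \<omega>) > \<epsilon>}"
    by auto
  \<comment> \<open>The moment hypothesis involves only the absolute deviation from the mean, so
    \<open>abs_minus_commute\<close> transfers it to \<open>?L\<close>.\<close>
  also have "prob \<dots> \<le> exp (- (1 / 16 * \<epsilon>\<^sup>2 * real N / M))"
    using X E
    by (intro centred_array_upper_tail[OF N L _ _ _ _ eps]) (auto simp: prob_space abs_minus_commute)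
  finally show "prob {\<omega> \<in> space P. 1 / (real N)\<^sup>2 * (\<Sum>i=1..N. \<Sum>j=1..N. ?U i j \<omega>) < - \<epsilon>}
      \<le> exp (- (1 / 16 * \<epsilon>\<^sup>2 * real N / M))" .
qed simp

end
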